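(* Let $L$ be a finite distributive lattice. If the poset $J(L)$ is not an initial segment of a finite upper semilattice, then $L$ is not isomorphic to any interval $[\mathbf{a},\mathbf{b}]$ of the Muchnik lattice $\mathcal{M}_w$.
   Context: Mass problems are subsets of Baire space $\omega^\omega$. For mass problems $\mathcal{A},\mathcal{B}$, Muchnik reducibility is $\mathcal{A}\le_w\mathcal{B}$ iff for every $f\in\mathcal{B}$ there is $g\in\mathcal{A}$ with $g\le_T f$; $\equiv_w$ is the induced equivalence. The Muchnik lattice $\mathcal{M}_w$ is the set of $\equiv_w$-classes ordered by $\le_w$ (a distributive lattice). $[a,b]=\{x:a\le x\le b\}$. $J(L)$ is the set of nonzero join-irreducible elements of $L$, ordered as in $L$. A poset $P$ is an initial segment of a finite upper semilattice if $P$ is isomorphic to a downward closed subset of some finite partial order in which every two elements have a least upper bound. *)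

theory Defs
  imports Main
begin

section \<open>Relative computability\<close>

text \<open>Codes for the partial functions that are \<open>\<mu>\<close>-recursive in a given total function,
  whose values are returned by the code \<open>Query\<close>. Codes carry no arity; the rules below determine
  on which argument lists a code is defined.\<close>

datatype code =
    Zero
  | Succ
  | Proj nat
  | Query
  | Comp code "code list"
  | Prec code code
  | Mu code

text \<open>\<open>computes f c xs y\<close>: relative to \<open>f\<close>, the code \<open>c\<close> halts on \<open>xs\<close> with value \<open>y\<close>.
  The last rule is unbounded search: all values before the first zero must be defined.\<close>

inductive computes :: "(nat \<Rightarrow> nat) \<Rightarrow> code \<Rightarrow> nat list \<Rightarrow> nat \<Rightarrow> bool"
  for f :: "nat \<Rightarrow> nat" where
  zero: "computes f Zero xs 0"
| succ: "computes f Succ [x] (Suc x)"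
| proj: "i < length xs \<Longrightarrow> computes f (Proj i) xs (xs ! i)"
| query: "computes f Query [x] (f x)"
| comp: "list_all2 (\<lambda>c y. computes f c xs y) cs ys \<Longrightarrow> computes f d ys z
    \<Longrightarrow> computes f (Comp d cs) xs z"
| prec_0: "computes f c xs y \<Longrightarrow> computes f (Prec c d) (0 # xs) y"
| prec_Suc: "computes f (Prec c d) (n # xs) r \<Longrightarrow> computes f d (n # r # xs) y
    \<Longrightarrow> computes f (Prec c d) (Suc n # xs) y"
| mu: "computes f c (n # xs) 0 \<Longrightarrow> (\<forall>i<n. \<exists>y>0. computes f c (i # xs) y)
    \<Longrightarrow> computes f (Mu c) xs n"

inductive_cases computes_ZeroE: "computes f Zero xs y"
inductive_cases computes_SuccE: "computes f Succ xs y"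
inductive_cases computes_ProjE: "computes f (Proj i) xs y"
inductive_cases computes_QueryE: "computes f Query xs y"
inductive_cases computes_CompE: "computes f (Comp d cs) xs y"
inductive_cases computes_Prec_0E: "computes f (Prec c d) (0 # xs) y"
inductive_cases computes_Prec_SucE: "computes f (Prec c d) (Suc n # xs) y"
inductive_cases computes_MuE: "computes f (Mu c) xs y"

lemma computes_unique: "computes f c xs y \<Longrightarrow> computes f c xs z \<Longrightarrow> y = z"
proof (induction arbitrary: z rule: computes.induct)
  case (comp xs cs ys d w)
  from comp.prems obtain ys' where
    ys': "list_all2 (\<lambda>c y. computes f c xs y) cs ys'" "computes f d ys' z"
    by (rule computes_CompE)
  have "ys = ys'"
    using comp.IH(1) ys'(1) unfolding list_all2_conv_all_nth by (metis nth_equalityI)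
  with comp.IH(2) ys'(2) show ?case by blast
next
  case (prec_Suc c d n xs r y)
  from prec_Suc.prems obtain r' where
    "computes f (Prec c d) (n # xs) r'" "computes f d (n # r' # xs) z"
    by (rule computes_Prec_SucE)
  with prec_Suc.IH show ?case by blast
next
  case (mu c n xs)
  from mu.prems have z: "computes f c (z # xs) 0" "\<forall>i<z. \<exists>y>0. computes f c (i # xs) y"
    by (rule computes_MuE; simp)+
  have "\<not> n < z" using z(2) mu.IH(1) by fastforce
  moreover have "\<not> z < n" using z(1) mu.IH(2) by fastforce
  ultimately show ?case by simp
next
  case (zero xs)
  then show ?case by (auto elim: computes_ZeroE)
next
  case (succ x)
  then show ?case by (auto elim: computes_SuccE)
next
  case (proj i xs)
  then show ?case by (auto elim: computes_ProjE)
next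
  case (query x)
  then show ?case by (auto elim: computes_QueryE)
next
  case (prec_0 c xs y d)
  from prec_0.prems have "computes f c xs z" by (rule computes_Prec_0E)
  then show ?case by (rule prec_0.IH)
qed

definition turing_le :: "(nat \<Rightarrow> nat) \<Rightarrow> (nat \<Rightarrow> nat) \<Rightarrow> bool"  (infix \<open>\<le>\<^sub>T\<close> 50) where
  "g \<le>\<^sub>T f \<longleftrightarrow> (\<exists>c. \<forall>x. computes f c [x] (g x))"

lemma turing_le_refl: "f \<le>\<^sub>T f"
  unfolding turing_le_def using computes.query by blast

primrec replace_query :: "code \<Rightarrow> code \<Rightarrow> code" where
  "replace_query d Zero = Zero"
| "replace_query d Succ = Succ"
| "replace_query d (Proj i) = Proj i"
| "replace_query d Query = d"
| "replace_query d (Comp c cs) = Comp (replace_query d c) (map (replace_query d) cs)"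
| "replace_query d (Prec c e) = Prec (replace_query d c) (replace_query d e)"
| "replace_query d (Mu c) = Mu (replace_query d c)"

lemma computes_replace_query:
  assumes d: "\<And>x. computes f d [x] (g x)"
  shows "computes g c xs y \<Longrightarrow> computes f (replace_query d c) xs y"
proof (induction rule: computes.induct)
  case (comp xs cs ys c z)
  have "list_all2 (\<lambda>c y. computes f c xs y) (map (replace_query d) cs) ys"
    using comp.IH(1) by (auto simp: list_all2_conv_all_nth)
  with comp.IH(2) show ?case by (auto intro: computes.comp)
next
  case (mu c n xs)
  then show ?case by (auto intro!: computes.mu)
next
  case (prec_Suc c e n xs r y)
  from prec_Suc.IH show ?case unfolding replace_query.simps by (rule computes.prec_Suc)
qed (simp_all add: computes.zero computes.succ computes.proj computes.prec_0 d)

lemma turing_le_trans: "g \<le>\<^sub>T f \<Longrightarrow> f \<le>\<^sub>T h \<Longrightarrow> g \<le>\<^sub>T h"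
proof -
  assume "g \<le>\<^sub>T f" "f \<le>\<^sub>T h"
  then obtain c d where "\<And>x. computes f c [x] (g x)" and "\<And>x. computes h d [x] (f x)"
    unfolding turing_le_def by blast
  then have "computes h (replace_query d c) [x] (g x)" for x
    by (intro computes_replace_query)
  then show "g \<le>\<^sub>T h" unfolding turing_le_def by blast
qed

definition turing_join :: "(nat \<Rightarrow> nat) \<Rightarrow> (nat \<Rightarrow> nat) \<Rightarrow> nat \<Rightarrow> nat"  (infixl \<open>\<oplus>\<^sub>T\<close> 65) where
  "f \<oplus>\<^sub>T g = (\<lambda>n. if even n then f (n div 2) else g (n div 2))"

lemma computes_comp1:
  "computes f c xs y \<Longrightarrow> computes f d [y] z \<Longrightarrow> computes f (Comp d [c]) xs z"
  by (rule computes.comp[where ys = "[y]"]) auto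

lemma computes_comp2:
  "computes f c xs y \<Longrightarrow> computes f c' xs y' \<Longrightarrow> computes f d [y, y'] z
    \<Longrightarrow> computes f (Comp d [c, c']) xs z"
  by (rule computes.comp[where ys = "[y, y']"]) auto

lemma computes_comp3:
  "computes f c xs y \<Longrightarrow> computes f c' xs y' \<Longrightarrow> computes f c'' xs y''
    \<Longrightarrow> computes f d [y, y', y''] z \<Longrightarrow> computes f (Comp d [c, c', c'']) xs z"
  by (rule computes.comp[where ys = "[y, y', y'']"]) auto

lemma computes_proj: "i < length xs \<Longrightarrow> y = xs ! i \<Longrightarrow> computes f (Proj i) xs y"
  using computes.proj by simp

definition add_code :: code where
  "add_code = Prec (Proj 0) (Comp Succ [Proj 1])"

lemma computes_add: "computes f add_code [m, n] (m + n)"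
  unfolding add_code_def
proof (induction m)
  case 0
  show ?case by (auto intro!: computes.prec_0 computes_proj)
next
  case (Suc m)
  have "computes f (Comp Succ [Proj 1]) [m, m + n, n] (Suc (m + n))"
    by (auto intro!: computes_comp1[where y = "m + n"] computes_proj computes.succ)
  with Suc show ?case by (auto intro: computes.prec_Suc)
qed

definition parity_code :: code where
  "parity_code = Prec Zero (Comp (Prec (Comp Succ [Zero]) Zero) [Proj 1])"

lemma computes_parity: "computes f parity_code [n] (n mod 2)"
  unfolding parity_code_def
proof (induction n)
  case 0
  show ?case by (auto intro!: computes.prec_0 computes.zero)
next
  case (Suc n)
  have neg: "computes f (Prec (Comp Succ [Zero]) Zero) [b] (1 - b)" for b
  proof (induction b)
    case 0
    have "computes f (Comp Succ [Zero]) [] (Suc 0)"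
      by (rule computes_comp1[OF computes.zero computes.succ])
    then show ?case by (auto intro: computes.prec_0)
  next
    case (Suc b)
    then show ?case by (auto intro: computes.prec_Suc computes.zero)
  qed
  have "computes f (Comp (Prec (Comp Succ [Zero]) Zero) [Proj 1]) [n, n mod 2] (1 - n mod 2)"
    by (rule computes_comp1[OF _ neg]) (auto intro: computes_proj)
  moreover have "1 - n mod 2 = Suc n mod 2" by presburger
  ultimately show ?case using Suc by (auto intro: computes.prec_Suc)
qed

definition half_code :: code where
  "half_code = Prec Zero (Comp add_code [Comp parity_code [Proj 0], Proj 1])"

lemma computes_half: "computes f half_code [n] (n div 2)"
  unfolding half_code_def
proof (induction n)
  case 0
  show ?case by (auto intro!: computes.prec_0 computes.zero)
next
  case (Suc n)
  have "computes f (Comp add_code [Comp parity_code [Proj 0], Proj 1]) [n, n div 2]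
      (n mod 2 + n div 2)"
    by (rule computes_comp2[OF computes_comp1[OF _ computes_parity] _ computes_add])
      (auto intro: computes_proj)
  moreover have "n mod 2 + n div 2 = Suc n div 2" by presburger
  ultimately show ?case using Suc by (auto intro: computes.prec_Suc)
qed

definition if_code :: code where
  "if_code = Prec (Proj 0) (Proj 3)"

lemma computes_if: "computes f if_code [b, x, y] (if b = 0 then x else y)"
  unfolding if_code_def
proof (induction b)
  case 0
  show ?case by (auto intro!: computes.prec_0 computes_proj)
next
  case (Suc b)
  then show ?case by (auto intro!: computes.prec_Suc computes_proj split: if_splits)
qed

lemma turing_le_join1: "f \<le>\<^sub>T f \<oplus>\<^sub>T g"
proof -
  have "computes (f \<oplus>\<^sub>T g) (Comp Query [Comp add_code [Proj 0, Proj 0]]) [x] (f x)" for x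
  proof -
    have "computes (f \<oplus>\<^sub>T g) (Comp add_code [Proj 0, Proj 0]) [x] (x + x)"
      by (rule computes_comp2[OF _ _ computes_add]) (auto intro: computes_proj)
    moreover have "(f \<oplus>\<^sub>T g) (x + x) = f x"
      by (simp add: turing_join_def flip: mult_2)
    ultimately show ?thesis by (metis computes_comp1 computes.query)
  qed
  then show ?thesis unfolding turing_le_def by blast
qed

lemma turing_le_join2: "g \<le>\<^sub>T f \<oplus>\<^sub>T g"
proof -
  have "computes (f \<oplus>\<^sub>T g) (Comp Query [Comp Succ [Comp add_code [Proj 0, Proj 0]]]) [x] (g x)"
    for x
  proof -
    have "computes (f \<oplus>\<^sub>T g) (Comp add_code [Proj 0, Proj 0]) [x] (x + x)"
      by (rule computes_comp2[OF _ _ computes_add]) (auto intro: computes_proj)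
    moreover have "(f \<oplus>\<^sub>T g) (Suc (x + x)) = g x"
      by (simp add: turing_join_def flip: mult_2)
    ultimately show ?thesis by (metis computes_comp1 computes.query computes.succ)
  qed
  then show ?thesis unfolding turing_le_def by blast
qed

lemma turing_join_least:
  assumes "f \<le>\<^sub>T h" "g \<le>\<^sub>T h"
  shows "f \<oplus>\<^sub>T g \<le>\<^sub>T h"
proof -
  obtain c d where c: "\<And>x. computes h c [x] (f x)" and d: "\<And>x. computes h d [x] (g x)"
    using assms unfolding turing_le_def by blast
  have "computes h (Comp if_code [parity_code, Comp c [half_code], Comp d [half_code]]) [x]
      (if x mod 2 = 0 then f (x div 2) else g (x div 2))" for x
    by (intro computes_comp3[OF computes_parity _ _ computes_if] computes_comp1[OF computes_half] c d)
  then have "computes h (Comp if_code [parity_code, Comp c [half_code], Comp d [half_code]]) [x]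
      ((f \<oplus>\<^sub>T g) x)" for x
    by (simp only: turing_join_def even_iff_mod_2_eq_zero)
  then show ?thesis unfolding turing_le_def by blast
qed


section \<open>The Muchnik lattice\<close>

definition muchnik_le :: "(nat \<Rightarrow> nat) set \<Rightarrow> (nat \<Rightarrow> nat) set \<Rightarrow> bool"  (infix \<open>\<le>\<^sub>w\<close> 50) where
  "A \<le>\<^sub>w B \<longleftrightarrow> (\<forall>f\<in>B. \<exists>g\<in>A. g \<le>\<^sub>T f)"

definition muchnik_equiv :: "(nat \<Rightarrow> nat) set \<Rightarrow> (nat \<Rightarrow> nat) set \<Rightarrow> bool"  (infix \<open>\<equiv>\<^sub>w\<close> 50) where
  "A \<equiv>\<^sub>w B \<longleftrightarrow> A \<le>\<^sub>w B \<and> B \<le>\<^sub>w A"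

lemma muchnik_le_refl: "A \<le>\<^sub>w A"
  unfolding muchnik_le_def using turing_le_refl by blast

lemma muchnik_le_trans: "A \<le>\<^sub>w B \<Longrightarrow> B \<le>\<^sub>w C \<Longrightarrow> A \<le>\<^sub>w C"
  unfolding muchnik_le_def using turing_le_trans by meson

quotient_type muchnik = "(nat \<Rightarrow> nat) set" / muchnik_equiv
  by (rule equivpI)
    (auto simp: reflp_def symp_def transp_def muchnik_equiv_def
      intro: muchnik_le_refl muchnik_le_trans)

instantiation muchnik :: distrib_lattice
begin

lift_definition less_eq_muchnik :: "muchnik \<Rightarrow> muchnik \<Rightarrow> bool" is muchnik_le
  unfolding muchnik_equiv_def using muchnik_le_trans by blast

definition less_muchnik :: "muchnik \<Rightarrow> muchnik \<Rightarrow> bool" where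
  "less_muchnik a b \<longleftrightarrow> a \<le> b \<and> \<not> b \<le> a"

lift_definition inf_muchnik :: "muchnik \<Rightarrow> muchnik \<Rightarrow> muchnik" is "(\<union>)"
  unfolding muchnik_equiv_def muchnik_le_def by (meson Un_iff)

lift_definition sup_muchnik :: "muchnik \<Rightarrow> muchnik \<Rightarrow> muchnik"
  is "\<lambda>A B. {f \<oplus>\<^sub>T g | f g. f \<in> A \<and> g \<in> B}"
proof -
  have "{f \<oplus>\<^sub>T g | f g. f \<in> A \<and> g \<in> B} \<le>\<^sub>w {f \<oplus>\<^sub>T g | f g. f \<in> A' \<and> g \<in> B'}"
    if "A \<le>\<^sub>w A'" "B \<le>\<^sub>w B'" for A A' B B'
    unfolding muchnik_le_def
  proof
    fix h assume "h \<in> {f \<oplus>\<^sub>T g | f g. f \<in> A' \<and> g \<in> B'}"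
    then obtain f g where h: "h = f \<oplus>\<^sub>T g" "f \<in> A'" "g \<in> B'" by blast
    then obtain f' g' where "f' \<in> A" "g' \<in> B" "f' \<le>\<^sub>T f" "g' \<le>\<^sub>T g"
      using \<open>A \<le>\<^sub>w A'\<close> \<open>B \<le>\<^sub>w B'\<close> unfolding muchnik_le_def by blast
    moreover from this have "f' \<oplus>\<^sub>T g' \<le>\<^sub>T h"
      unfolding h by (meson turing_join_least turing_le_join1 turing_le_join2 turing_le_trans)
    ultimately show "\<exists>k\<in>{f \<oplus>\<^sub>T g | f g. f \<in> A \<and> g \<in> B}. k \<le>\<^sub>T h" by blast
  qed
  then show "{f \<oplus>\<^sub>T g | f g. f \<in> A \<and> g \<in> B} \<equiv>\<^sub>w {f \<oplus>\<^sub>T g | f g. f \<in> A' \<and> g \<in> B'}"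
    if "A \<equiv>\<^sub>w A'" "B \<equiv>\<^sub>w B'" for A A' B B'
    using that unfolding muchnik_equiv_def by presburger
qed

instance
proof
  fix x y z :: muchnik
  show "x < y \<longleftrightarrow> x \<le> y \<and> \<not> y \<le> x" by (rule less_muchnik_def)
  show "x \<le> x" by transfer (rule muchnik_le_refl)
  show "x \<le> y \<Longrightarrow> y \<le> z \<Longrightarrow> x \<le> z" by transfer (rule muchnik_le_trans)
  show "x \<le> y \<Longrightarrow> y \<le> x \<Longrightarrow> x = y" by transfer (simp add: muchnik_equiv_def)
  show "inf x y \<le> x" by transfer (auto simp: muchnik_le_def intro: turing_le_refl)
  show "inf x y \<le> y" by transfer (auto simp: muchnik_le_def intro: turing_le_refl)
  show "x \<le> y \<Longrightarrow> x \<le> z \<Longrightarrow> x \<le> inf y z" by transfer (auto simp: muchnik_le_def)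
  show "x \<le> sup x y" by transfer (auto simp: muchnik_le_def intro: turing_le_join1)
  show "y \<le> sup x y" by transfer (auto simp: muchnik_le_def intro: turing_le_join2)
  show "y \<le> x \<Longrightarrow> z \<le> x \<Longrightarrow> sup y z \<le> x"
    by transfer (simp add: muchnik_le_def, blast intro: turing_join_least)
  show "sup x (inf y z) = inf (sup x y) (sup x z)"
  proof transfer
    fix A B C :: "(nat \<Rightarrow> nat) set"
    have "{f \<oplus>\<^sub>T g | f g. f \<in> A \<and> g \<in> B \<union> C}
        = {f \<oplus>\<^sub>T g | f g. f \<in> A \<and> g \<in> B} \<union> {f \<oplus>\<^sub>T g | f g. f \<in> A \<and> g \<in> C}" by blast
    then show "{f \<oplus>\<^sub>T g | f g. f \<in> A \<and> g \<in> B \<union> C}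
        \<equiv>\<^sub>w {f \<oplus>\<^sub>T g | f g. f \<in> A \<and> g \<in> B} \<union> {f \<oplus>\<^sub>T g | f g. f \<in> A \<and> g \<in> C}"
      by (simp add: muchnik_equiv_def muchnik_le_refl)
  qed
qed

end


section \<open>Finite posets\<close>

definition order_isomorphic ::
    "'a set \<Rightarrow> ('a \<Rightarrow> 'a \<Rightarrow> bool) \<Rightarrow> 'b set \<Rightarrow> ('b \<Rightarrow> 'b \<Rightarrow> bool) \<Rightarrow> bool" where
  "order_isomorphic A le B le' \<longleftrightarrow>
    (\<exists>h. bij_betw h A B \<and> (\<forall>x\<in>A. \<forall>y\<in>A. le x y \<longleftrightarrow> le' (h x) (h y)))"

text \<open>A finite lattice type has a least element without being an instance of a class that names
  it, so "nonzero" is expressed as not being least.\<close>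

definition join_irreducibles :: "'a::lattice set" where
  "join_irreducibles =
    {x. \<not> (\<forall>y. x \<le> y) \<and> (\<forall>y z. x = sup y z \<longrightarrow> x = y \<or> x = z)}"

definition finite_upper_semilattice :: "'a set \<Rightarrow> ('a \<Rightarrow> 'a \<Rightarrow> bool) \<Rightarrow> bool" where
  "finite_upper_semilattice U le \<longleftrightarrow>
    finite U \<and> reflp_on U le \<and> transp_on U le \<and> antisymp_on U le \<and>
    (\<forall>x\<in>U. \<forall>y\<in>U. \<exists>z\<in>U. le x z \<and> le y z \<and> (\<forall>w\<in>U. le x w \<and> le y w \<longrightarrow> le z w))"

definition downward_closed :: "'a set \<Rightarrow> 'a set \<Rightarrow> ('a \<Rightarrow> 'a \<Rightarrow> bool) \<Rightarrow> bool" where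
  "downward_closed D U le \<longleftrightarrow> D \<subseteq> U \<and> (\<forall>x\<in>D. \<forall>y\<in>U. le y x \<longrightarrow> y \<in> D)"

text \<open>Taking the carrier of the semilattice inside \<open>nat\<close> loses nothing, since the carrier is
  finite; the lemma below gives the version with a carrier in an arbitrary type.\<close>

definition initial_segment_of_finite_usl :: "'a set \<Rightarrow> ('a \<Rightarrow> 'a \<Rightarrow> bool) \<Rightarrow> bool" where
  "initial_segment_of_finite_usl P le \<longleftrightarrow>
    (\<exists>(U :: nat set) le' D. finite_upper_semilattice U le' \<and> downward_closed D U le' \<and>
      order_isomorphic P le D le')"

lemma initial_segment_of_finite_uslI:
  fixes U :: "'b set"
  assumes usl: "finite_upper_semilattice U le'" and D: "downward_closed D U le'"
    and iso: "order_isomorphic P le D le'"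
  shows "initial_segment_of_finite_usl P le"
proof -
  have "finite U" using usl by (simp add: finite_upper_semilattice_def)
  then obtain e :: "'b \<Rightarrow> nat" where e: "inj_on e U"
    using finite_imp_inj_to_nat_seg by blast
  define r where "r m n = le' (inv_into U e m) (inv_into U e n)" for m n
  have r: "r (e x) (e y) \<longleftrightarrow> le' x y" if "x \<in> U" "y \<in> U" for x y
    using that e by (simp add: r_def)
  have DU: "D \<subseteq> U" using D by (simp add: downward_closed_def)
  have "finite_upper_semilattice (e ` U) r"
    unfolding finite_upper_semilattice_def
  proof (intro conjI ballI)
    show "finite (e ` U)" using \<open>finite U\<close> by simp
    show "reflp_on (e ` U) r"
      using usl by (auto simp: finite_upper_semilattice_def r intro!: reflp_onI dest: reflp_onD)
    show "transp_on (e ` U) r"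
      using usl by (auto simp: finite_upper_semilattice_def r intro!: transp_onI dest: transp_onD)
    show "antisymp_on (e ` U) r"
      using usl by (auto simp: finite_upper_semilattice_def r intro!: antisymp_onI dest: antisymp_onD)
    fix m n assume "m \<in> e ` U" "n \<in> e ` U"
    then obtain x y where xy: "m = e x" "x \<in> U" "n = e y" "y \<in> U" by blast
    have "\<forall>x\<in>U. \<forall>y\<in>U. \<exists>z\<in>U. le' x z \<and> le' y z \<and> (\<forall>w\<in>U. le' x w \<and> le' y w \<longrightarrow> le' z w)"
      using usl unfolding finite_upper_semilattice_def by (elim conjE)
    from this[rule_format, OF xy(2,4)]
    obtain z where "z \<in> U" "le' x z" "le' y z" "\<forall>w\<in>U. le' x w \<and> le' y w \<longrightarrow> le' z w"
      by (elim bexE conjE)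
    with xy show "\<exists>k\<in>e ` U. r m k \<and> r n k \<and> (\<forall>w\<in>e ` U. r m w \<and> r n w \<longrightarrow> r k w)"
      by (intro bexI[where x = "e z"]) (auto simp: r)
  qed
  moreover have "downward_closed (e ` D) (e ` U) r"
    unfolding downward_closed_def
  proof (intro conjI ballI impI)
    show "e ` D \<subseteq> e ` U" using DU by (rule image_mono)
    fix m n assume "m \<in> e ` D" "n \<in> e ` U" "r n m"
    then obtain x y where xy: "m = e x" "x \<in> D" "n = e y" "y \<in> U" by blast
    with \<open>r n m\<close> DU have "le' y x" by (auto simp: r)
    with xy D show "n \<in> e ` D" unfolding downward_closed_def by blast
  qed
  moreover have "order_isomorphic P le (e ` D) r"
  proof -
    obtain h where h: "bij_betw h P D" "\<And>x y. x \<in> P \<Longrightarrow> y \<in> P \<Longrightarrow> le x y \<longleftrightarrow> le' (h x) (h y)"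
      using iso unfolding order_isomorphic_def by blast
    have "bij_betw (e \<circ> h) P (e ` D)"
      using h(1) e DU by (meson bij_betw_trans inj_on_imp_bij_betw inj_on_subset)
    moreover have "le x y \<longleftrightarrow> r ((e \<circ> h) x) ((e \<circ> h) y)" if "x \<in> P" "y \<in> P" for x y
      using that h DU r by (metis bij_betwE comp_apply subsetD)
    ultimately show ?thesis unfolding order_isomorphic_def by blast
  qed
  ultimately show ?thesis unfolding initial_segment_of_finite_usl_def by blast
qed

end

theory Submission
  imports Defs
begin

text \<open>Up to \<open>\<equiv>\<^sub>w\<close>, a mass problem is its upward closure under \<open>\<le>\<^sub>T\<close>, and \<open>\<le>\<^sub>w\<close> becomes reverse
  inclusion. Taking complements in the upward closure \<open>A\<close> of \<open>a\<close> thus identifies \<open>[a, b]\<close> with the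
  lattice of downward closed subsets of \<open>P = A - B\<close>, where \<open>B\<close> is the upward closure of \<open>b\<close>. If this
  lattice is finite, its join-irreducibles are the principal downsets, as in Birkhoff's theorem, so
  \<open>J(L)\<close> is \<open>P\<close> modulo Turing equivalence. Two elements of \<open>P\<close> with an upper bound in \<open>P\<close> have their
  Turing join in \<open>P\<close>: it lies in \<open>A\<close> because it is above elements of \<open>A\<close>, and not in \<open>B\<close> because
  it is below an element outside \<open>B\<close>. Hence bounded pairs in \<open>J(L)\<close> have joins, and adjoining a
  top element to \<open>J(L)\<close> yields an upper semilattice.\<close>

lemma order_isomorphic_trans:
  assumes "order_isomorphic A le B le'" "order_isomorphic B le' C le''"
  shows "order_isomorphic A le C le''"
proof -
  obtain f where f: "bij_betw f A B" "\<forall>x\<in>A. \<forall>y\<in>A. le x y \<longleftrightarrow> le' (f x) (f y)"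
    using assms(1) unfolding order_isomorphic_def by blast
  obtain g where g: "bij_betw g B C" "\<forall>x\<in>B. \<forall>y\<in>B. le' x y \<longleftrightarrow> le'' (g x) (g y)"
    using assms(2) unfolding order_isomorphic_def by blast
  have "bij_betw (g \<circ> f) A C" using f(1) g(1) by (rule bij_betw_trans)
  moreover have "\<forall>x\<in>A. \<forall>y\<in>A. le x y \<longleftrightarrow> le'' ((g \<circ> f) x) ((g \<circ> f) y)"
    using f g(2) by (simp add: bij_betw_apply)
  ultimately show ?thesis unfolding order_isomorphic_def by blast
qed

definition bounded_joins_on :: "'a set \<Rightarrow> ('a \<Rightarrow> 'a \<Rightarrow> bool) \<Rightarrow> bool" where
  "bounded_joins_on P le \<longleftrightarrow>
    (\<forall>x\<in>P. \<forall>y\<in>P. \<forall>u\<in>P. le x u \<and> le y u \<longrightarrow>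
      (\<exists>z\<in>P. le x z \<and> le y z \<and> (\<forall>w\<in>P. le x w \<and> le y w \<longrightarrow> le z w)))"

lemma bounded_joins_onD:
  assumes "bounded_joins_on P le" "x \<in> P" "y \<in> P" "u \<in> P" "le x u" "le y u"
  shows "\<exists>z\<in>P. le x z \<and> le y z \<and> (\<forall>w\<in>P. le x w \<and> le y w \<longrightarrow> le z w)"
  using assms(1)[unfolded bounded_joins_on_def, rule_format, OF assms(2-4)] assms(5,6) by simp

definition upward_closed :: "'a set \<Rightarrow> ('a \<Rightarrow> 'a \<Rightarrow> bool) \<Rightarrow> bool" where
  "upward_closed X le \<longleftrightarrow> (\<forall>x\<in>X. \<forall>y. le x y \<longrightarrow> y \<in> X)"

lemma bounded_joins_on_Diff:
  assumes joins: "bounded_joins_on UNIV le"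
    and A: "upward_closed A le" and B: "upward_closed B le"
  shows "bounded_joins_on (A - B) le"
  unfolding bounded_joins_on_def
proof (intro ballI impI)
  fix x y u
  assume x: "x \<in> A - B" and u: "u \<in> A - B" and bound: "le x u \<and> le y u"
  then obtain z where z: "le x z" "le y z" and least: "\<forall>w. le x w \<and> le y w \<longrightarrow> le z w"
    using bounded_joins_onD[OF joins UNIV_I UNIV_I UNIV_I, of x u y] by auto
  have "z \<in> A" using A x z(1) unfolding upward_closed_def by blast
  moreover have "z \<notin> B" using B u bound least unfolding upward_closed_def by blast
  ultimately show "\<exists>z\<in>A - B. le x z \<and> le y z \<and> (\<forall>w\<in>A - B. le x w \<and> le y w \<longrightarrow> le z w)"
    using z least by blast
qed

lemma bounded_joins_on_image:
  assumes "bounded_joins_on P le"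
    and "\<And>x y. x \<in> P \<Longrightarrow> y \<in> P \<Longrightarrow> le' (f x) (f y) \<longleftrightarrow> le x y"
  shows "bounded_joins_on (f ` P) le'"
  using assms unfolding bounded_joins_on_def by simp

definition with_top :: "('a \<Rightarrow> 'a \<Rightarrow> bool) \<Rightarrow> 'a option \<Rightarrow> 'a option \<Rightarrow> bool" where
  "with_top le x y \<longleftrightarrow> y = None \<or> rel_option le x y"

lemma with_top_simps [simp]:
  "with_top le p None"
  "with_top le (Some x) (Some y) \<longleftrightarrow> le x y"
  "\<not> with_top le None (Some y)"
  by (simp_all add: with_top_def)

lemma finite_upper_semilattice_with_top:
  assumes fin: "finite P"
    and order: "reflp_on P le" "transp_on P le" "antisymp_on P le"
    and joins: "bounded_joins_on P le"
  shows "finite_upper_semilattice (insert None (Some ` P)) (with_top le)"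
    (is "finite_upper_semilattice ?U _")
  unfolding finite_upper_semilattice_def
proof (intro conjI ballI)
  show "finite ?U" using fin by simp
  show "reflp_on ?U (with_top le)"
    by (rule reflp_onI) (auto intro: reflp_onD[OF order(1)])
  show "transp_on ?U (with_top le)"
    by (rule transp_onI) (auto intro: transp_onD[OF order(2)])
  show "antisymp_on ?U (with_top le)"
    by (rule antisymp_onI) (auto intro: antisymp_onD[OF order(3)])
  fix p q assume pq: "p \<in> ?U" "q \<in> ?U"
  show "\<exists>r\<in>?U. with_top le p r \<and> with_top le q r \<and>
      (\<forall>w\<in>?U. with_top le p w \<and> with_top le q w \<longrightarrow> with_top le r w)"
  proof (cases "\<exists>u\<in>P. with_top le p (Some u) \<and> with_top le q (Some u)")
    case True
    with pq obtain x y u where "p = Some x" "q = Some y"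
      and bounded: "x \<in> P" "y \<in> P" "u \<in> P" "le x u" "le y u"
      by auto
    from bounded_joins_onD[OF joins bounded] obtain z
      where "z \<in> P" "le x z" "le y z" "\<forall>w\<in>P. le x w \<and> le y w \<longrightarrow> le z w"
      by (elim bexE conjE)
    with \<open>p = Some x\<close> \<open>q = Some y\<close> show ?thesis by (intro bexI[where x = "Some z"]) auto
  next
    case False
    then show ?thesis by (intro bexI[where x = None]) auto
  qed
qed

lemma initial_segment_of_finite_usl_bounded_joins:
  assumes "finite P" "reflp_on P le" "transp_on P le" "antisymp_on P le" "bounded_joins_on P le"
  shows "initial_segment_of_finite_usl P le"
proof (rule initial_segment_of_finite_uslI)
  show "finite_upper_semilattice (insert None (Some ` P)) (with_top le)"
    using assms by (rule finite_upper_semilattice_with_top)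
  show "downward_closed (Some ` P) (insert None (Some ` P)) (with_top le)"
    by (auto simp: downward_closed_def)
  show "order_isomorphic P le (Some ` P) (with_top le)"
    unfolding order_isomorphic_def by (rule exI[where x = Some]) (simp add: bij_betw_def)
qed

lemma join_irreducible_Sup_fin_mem:
  fixes T :: "'a::lattice set"
  assumes "finite T" "T \<noteq> {}" "Sup_fin T \<in> join_irreducibles"
  shows "Sup_fin T \<in> T"
  using assms
proof (induction rule: finite_ne_induct)
  case (insert t T)
  then have "Sup_fin (insert t T) = sup t (Sup_fin T)" by simp
  then have "Sup_fin (insert t T) = t \<or> Sup_fin (insert t T) = Sup_fin T"
    using insert.prems unfolding join_irreducibles_def by blast
  with insert show ?case by auto
qed simp

locale downset_lattice =
  fixes P :: "'p set" and le :: "'p \<Rightarrow> 'p \<Rightarrow> bool" and downset :: "'a::lattice \<Rightarrow> 'p set"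
  assumes reflp_on_le: "reflp_on P le"
    and transp_on_le: "transp_on P le"
    and bij_downset: "bij_betw downset UNIV {D. downward_closed D P le}"
    and le_iff_downset: "x \<le> y \<longleftrightarrow> downset x \<subseteq> downset y"
begin

lemma downward_closed_downset: "downward_closed (downset x) P le"
  using bij_betw_apply[OF bij_downset] by simp

lemma downset_subset: "downset x \<subseteq> P"
  using downward_closed_downset by (simp add: downward_closed_def)

lemma downset_surj:
  assumes "downward_closed D P le"
  obtains x where "downset x = D"
proof -
  have "D \<in> range downset" using bij_downset assms by (simp add: bij_betw_def)
  then show thesis using that by blast
qed

lemma downset_sup: "downset (sup x y) = downset x \<union> downset y"
proof (rule antisym)
  have "downward_closed (downset x \<union> downset y) P le"
    using downward_closed_downset unfolding downward_closed_def by blast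
  then obtain z where z: "downset z = downset x \<union> downset y" by (rule downset_surj)
  then have "sup x y \<le> z" by (intro sup_least) (simp_all add: le_iff_downset)
  then show "downset (sup x y) \<subseteq> downset x \<union> downset y" by (simp add: le_iff_downset z)
  show "downset x \<union> downset y \<subseteq> downset (sup x y)" by (simp flip: le_iff_downset)
qed

definition principal :: "'p \<Rightarrow> 'a" where
  "principal p = the_inv downset {q\<in>P. le q p}"

lemma downset_principal:
  assumes "p \<in> P"
  shows "downset (principal p) = {q\<in>P. le q p}"
proof -
  have "downward_closed {q\<in>P. le q p} P le"
    using assms transp_on_le by (auto simp: downward_closed_def dest: transp_onD)
  then show ?thesis
    using bij_downset unfolding principal_def bij_betw_def by (simp add: f_the_inv_into_f)
qed

lemma principal_le_iff:
  assumes "p \<in> P"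
  shows "principal p \<le> x \<longleftrightarrow> p \<in> downset x"
proof
  assume "principal p \<le> x"
  then show "p \<in> downset x"
    using assms reflp_on_le by (auto simp: le_iff_downset downset_principal dest: reflp_onD)
next
  assume "p \<in> downset x"
  then show "principal p \<le> x"
    using assms downward_closed_downset[of x]
    by (auto simp: le_iff_downset downset_principal downward_closed_def)
qed

lemma principal_le_principal_iff:
  "p \<in> P \<Longrightarrow> q \<in> P \<Longrightarrow> principal p \<le> principal q \<longleftrightarrow> le p q"
  by (simp add: principal_le_iff downset_principal)

lemma principal_join_irreducible:
  assumes p: "p \<in> P"
  shows "principal p \<in> join_irreducibles"
  unfolding join_irreducibles_def
proof (intro CollectI conjI allI impI)
  have "downward_closed {} P le" by (simp add: downward_closed_def)
  then obtain x where "downset x = {}" by (rule downset_surj)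
  then show "\<not> (\<forall>y. principal p \<le> y)" using p by (auto simp: principal_le_iff)
next
  fix y z assume eq: "principal p = sup y z"
  then have "p \<in> downset y \<union> downset z"
    using p by (metis downset_sup order_refl principal_le_iff)
  then have "principal p \<le> y \<or> principal p \<le> z" using p by (simp add: principal_le_iff)
  then show "principal p = y \<or> principal p = z" unfolding eq by (auto intro: antisym)
qed

lemma Sup_fin_principal:
  assumes fin: "finite (principal ` downset x)" and ne: "downset x \<noteq> {}"
  shows "Sup_fin (principal ` downset x) = x"
proof (rule antisym)
  have mem_P: "p \<in> P" if "p \<in> downset x" for p
    using that downset_subset by blast
  show "Sup_fin (principal ` downset x) \<le> x"
    by (rule Sup_fin.boundedI[OF fin]) (use ne in \<open>auto simp: principal_le_iff mem_P\<close>)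
  have "principal p \<le> Sup_fin (principal ` downset x)" if "p \<in> downset x" for p
    using that by (simp add: Sup_fin.coboundedI fin)
  then show "x \<le> Sup_fin (principal ` downset x)"
    by (auto simp: le_iff_downset[of x] principal_le_iff mem_P)
qed

lemma join_irreducibles_eq_principal:
  assumes "finite (UNIV :: 'a set)"
  shows "join_irreducibles = principal ` P"
proof (intro equalityI subsetI)
  fix x :: 'a
  assume x: "x \<in> join_irreducibles"
  then have ne: "downset x \<noteq> {}"
    unfolding join_irreducibles_def by (auto simp: le_iff_downset)
  have fin: "finite (principal ` downset x)" by (rule finite_subset[OF subset_UNIV assms])
  have "x \<in> principal ` downset x"
    using join_irreducible_Sup_fin_mem[OF fin] ne x by (simp add: Sup_fin_principal fin)
  then show "x \<in> principal ` P" using downset_subset by blast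
qed (auto intro: principal_join_irreducible)

end

lemma bounded_joins_on_join_irreducibles:
  assumes iso: "order_isomorphic (UNIV :: 'a::{finite, lattice} set) (\<le>)
      {D. downward_closed D P le} (\<subseteq>)"
    and "reflp_on P le" "transp_on P le" "bounded_joins_on P le"
  shows "bounded_joins_on (join_irreducibles :: 'a set) (\<le>)"
proof -
  obtain downset :: "'a \<Rightarrow> _" where "bij_betw downset UNIV {D. downward_closed D P le}"
    and "\<And>x y. x \<le> y \<longleftrightarrow> downset x \<subseteq> downset y"
    using iso unfolding order_isomorphic_def by blast
  with assms(2,3) interpret downset_lattice P le downset by unfold_locales
  show ?thesis
    unfolding join_irreducibles_eq_principal[OF finite]
    using assms(4) principal_le_principal_iff by (rule bounded_joins_on_image)
qed

lemma reflp_turing_le: "reflp (\<le>\<^sub>T)"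
  by (rule reflpI) (rule turing_le_refl)

lemma transp_turing_le: "transp (\<le>\<^sub>T)"
  by (rule transpI) (rule turing_le_trans)

lemma bounded_joins_on_turing_le: "bounded_joins_on UNIV (\<le>\<^sub>T)"
  unfolding bounded_joins_on_def
  using turing_le_join1 turing_le_join2 turing_join_least by blast

lift_definition muchnik_cone :: "muchnik \<Rightarrow> (nat \<Rightarrow> nat) set"
  is "\<lambda>A. {f. \<exists>g\<in>A. g \<le>\<^sub>T f}"
  unfolding muchnik_equiv_def muchnik_le_def by (blast intro: turing_le_trans)

lemma muchnik_le_iff_cone: "a \<le> b \<longleftrightarrow> muchnik_cone b \<subseteq> muchnik_cone a"
  by transfer (auto simp: muchnik_le_def intro: turing_le_refl turing_le_trans)

lemma upward_closed_muchnik_cone: "upward_closed (muchnik_cone a) (\<le>\<^sub>T)"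
  unfolding upward_closed_def by transfer (auto intro: turing_le_trans)

lemma muchnik_cone_abs_muchnik:
  "upward_closed X (\<le>\<^sub>T) \<Longrightarrow> muchnik_cone (abs_muchnik X) = X"
  unfolding muchnik_cone.abs_eq upward_closed_def by (blast intro: turing_le_refl)

lemma order_isomorphic_muchnik_interval:
  assumes "a \<le> b"
  shows "order_isomorphic {a..b} (\<le>)
    {D. downward_closed D (muchnik_cone a - muchnik_cone b) (\<le>\<^sub>T)} (\<subseteq>)"
    (is "order_isomorphic _ _ ?Downsets _")
proof -
  define compl where "compl c = muchnik_cone a - muchnik_cone c" for c
  have compl_le: "c \<le> d \<longleftrightarrow> compl c \<subseteq> compl d" if "c \<in> {a..b}" "d \<in> {a..b}" for c d
    using that by (auto simp: compl_def muchnik_le_iff_cone)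
  have "inj_on compl {a..b}"
    using compl_le by (metis antisym inj_onI order_refl)
  moreover have "compl c \<in> ?Downsets" if "c \<in> {a..b}" for c
    using that upward_closed_muchnik_cone[of c]
    by (auto simp: compl_def muchnik_le_iff_cone downward_closed_def upward_closed_def)
  moreover have "D \<in> compl ` {a..b}" if D: "D \<in> ?Downsets" for D
  proof
    let ?c = "abs_muchnik (muchnik_cone a - D)"
    have "upward_closed (muchnik_cone a - D) (\<le>\<^sub>T)"
      using D upward_closed_muchnik_cone[of a] upward_closed_muchnik_cone[of b]
      unfolding upward_closed_def downward_closed_def by blast
    then have cone: "muchnik_cone ?c = muchnik_cone a - D" by (rule muchnik_cone_abs_muchnik)
    show "D = compl ?c" using D by (auto simp: compl_def cone downward_closed_def)
    show "?c \<in> {a..b}"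
      using D assms by (auto simp: muchnik_le_iff_cone cone downward_closed_def)
  qed
  ultimately have "bij_betw compl {a..b} ?Downsets" unfolding bij_betw_def by blast
  with compl_le show ?thesis unfolding order_isomorphic_def by blast
qed

theorem theorem3p11:
  assumes "\<not> initial_segment_of_finite_usl
             (join_irreducibles :: 'a::{finite, distrib_lattice} set) (\<le>)"
  shows "\<not> (\<exists>a b :: muchnik. order_isomorphic (UNIV :: 'a set) (\<le>) {a..b} (\<le>))"
proof
  assume "\<exists>a b :: muchnik. order_isomorphic (UNIV :: 'a set) (\<le>) {a..b} (\<le>)"
  then obtain a b :: muchnik where iso: "order_isomorphic (UNIV :: 'a set) (\<le>) {a..b} (\<le>)"
    by blast
  let ?P = "muchnik_cone a - muchnik_cone b"
  have "{a..b} \<noteq> {}" using iso by (metis UNIV_not_empty bij_betw_empty2 order_isomorphic_def)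
  then have "a \<le> b" by simp
  then have "order_isomorphic (UNIV :: 'a set) (\<le>) {D. downward_closed D ?P (\<le>\<^sub>T)} (\<subseteq>)"
    by (rule order_isomorphic_trans[OF iso order_isomorphic_muchnik_interval])
  moreover have "bounded_joins_on ?P (\<le>\<^sub>T)"
    by (intro bounded_joins_on_Diff bounded_joins_on_turing_le upward_closed_muchnik_cone)
  moreover have "reflp_on ?P (\<le>\<^sub>T)" "transp_on ?P (\<le>\<^sub>T)"
    using reflp_turing_le transp_turing_le by (auto intro: reflp_on_subset transp_on_subset)
  ultimately have "bounded_joins_on (join_irreducibles :: 'a set) (\<le>)"
    by (intro bounded_joins_on_join_irreducibles)
  then have "initial_segment_of_finite_usl (join_irreducibles :: 'a set) (\<le>)"
    by (intro initial_segment_of_finite_usl_bounded_joins) simp_all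
  with assms show False by contradiction
qed

end
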